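(* Let $A$ be an operator on $\mathcal F_\lambda$. For each $g\in G$ and $z\in\mathbb C^n$, we have $$S_\lambda(\pi(g)^{-1}A\,\pi(g))(z)=S_\lambda(A)(g\cdot z).$$
   Context: Fix integers $n,m\ge 1$ and $\lambda>0$. For $z,w\in\mathbb C^n$ put $zw:=\sum_k z_kw_k$ (bilinear), $|z|^2=z\bar z$, and $\omega((z,w),(z',w')):=\tfrac i2(zw'-z'w)$. Let $\alpha_1,\dots,\alpha_n$ be linear forms on $\mathbb R^m$; $t\cdot z=(e^{i\alpha_1(t)}z_1,\dots,e^{i\alpha_n(t)}z_n)$ for $t\in\mathbb R^m$; $t^{-1}$ means $-t$. The generalized diamond group $G$ is $\mathbb R^m\times\mathbb C^n\times\mathbb R$ with $(t,z,c)\cdot(t',z',c')=(t+t',\,z+t\cdot z',\,c+c'+\tfrac12\omega((z,\bar z),(t\cdot z',\overline{t\cdot z'})))$. It acts on $\mathbb C^n$ by $(t,z_0,c_0)\cdot z=t\cdot z+z_0$. $\mathcal F_\lambda$ is the Hilbert space of holomorphic $f$ on $\mathbb C^n$ with $\int_{\mathbb C^n}|f(z)|^2e^{-\lambda|z|^2/2}d\mu_\lambda(z)<\infty$, $d\mu_\lambda=(2\pi)^{-n}\lambda^n\,dx\,dy$, $z=x+iy$. Fix a unitary character $\chi$ of $\mathbb R^m$; the unitary representation $\pi$ of $G$ on $\mathcal F_\lambda$ is $(\pi(t,z_0,c_0)f)(z)=\chi(t)\exp(i\lambda c_0+\tfrac\lambda2\bar z_0z-\tfrac\lambda4|z_0|^2)f(t^{-1}\cdot(z-z_0))$.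 Coherent states: $e_z(w)=\exp(\lambda\bar zw/2)$, so $f(z)=\langle f,e_z\rangle$. The Berezin symbol of a (linear, possibly unbounded) operator $A$ on $\mathcal F_\lambda$ whose domain contains all coherent states is $S_\lambda(A)(z)=\langle Ae_z,e_z\rangle/\langle e_z,e_z\rangle$, $z\in\mathbb C^n$. *)

theory Defs
  imports "HOL-Analysis.Analysis" "HOL-Algebra.Group"
begin

section \<open>The generalized diamond group\<close>

definition bil :: "complex^'n::finite \<Rightarrow> complex^'n \<Rightarrow> complex" where
  "bil z w = (\<Sum>k\<in>UNIV. z $ k * w $ k)"

definition vcnj :: "complex^'n::finite \<Rightarrow> complex^'n" where
  "vcnj z = (\<chi> k. cnj (z $ k))"

definition omega :: "(complex^'n::finite) \<times> (complex^'n) \<Rightarrow> (complex^'n) \<times> (complex^'n) \<Rightarrow> complex" where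
  "omega = (\<lambda>(z, w) (z', w'). \<i> / 2 * (bil z w' - bil z' w))"

definition torus_act :: "('n::finite \<Rightarrow> real^'m::finite \<Rightarrow> real) \<Rightarrow> real^'m \<Rightarrow> complex^'n \<Rightarrow> complex^'n" where
  "torus_act \<alpha> t z = (\<chi> k. cis (\<alpha> k t) * z $ k)"

type_synonym ('n, 'm) diamond = "(real^'m) \<times> (complex^'n) \<times> real"

text \<open>Since \<open>omega (z, vcnj z) (w, vcnj w)\<close> is always real (it equals minus the imaginary part
  of \<open>bil z (vcnj w)\<close>), taking the real part below only converts the type.\<close>

definition diamond_group ::
    "('n::finite \<Rightarrow> real^'m::finite \<Rightarrow> real) \<Rightarrow> ('n, 'm) diamond monoid" where
  "diamond_group \<alpha> =
     \<lparr>carrier = UNIV,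
      mult = (\<lambda>(t, z, c) (t', z', c').
        (t + t', z + torus_act \<alpha> t z',
         c + c' + 1 / 2 * Re (omega (z, vcnj z) (torus_act \<alpha> t z', vcnj (torus_act \<alpha> t z'))))),
      one = (0, 0, 0)\<rparr>"

definition diamond_act ::
    "('n::finite \<Rightarrow> real^'m::finite \<Rightarrow> real) \<Rightarrow> ('n, 'm) diamond \<Rightarrow> complex^'n \<Rightarrow> complex^'n" where
  "diamond_act \<alpha> = (\<lambda>(t, z0, c0) z. torus_act \<alpha> t z + z0)"

definition unitary_character :: "(real^'m::finite \<Rightarrow> complex) \<Rightarrow> bool" where
  "unitary_character ch \<longleftrightarrow>
     continuous_on UNIV ch \<and> (\<forall>t. norm (ch t) = 1) \<and> (\<forall>s t. ch (s + t) = ch s * ch t)"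


section \<open>The Fock space\<close>

text \<open>Holomorphy in several variables: real Frechet differentiability everywhere with
  complex-linear derivative.\<close>

definition entire_vec :: "(complex^'n::finite \<Rightarrow> complex) \<Rightarrow> bool" where
  "entire_vec f \<longleftrightarrow>
     (\<forall>z. \<exists>f'. (f has_derivative f') (at z) \<and> (\<forall>c v. f' (c *s v) = c * f' v))"

text \<open>On \<open>complex^'n\<close>, \<open>lborel\<close> is Lebesgue measure \<open>dx dy\<close> in the \<open>2n\<close> real coordinates and
  \<open>norm\<close> is the Hermitian norm.\<close>

definition mu :: "real \<Rightarrow> (complex^'n::finite) measure" where
  "mu lam = density lborel (\<lambda>_. ennreal (lam ^ CARD('n) / (2 * pi) ^ CARD('n)))"

definition fock :: "real \<Rightarrow> (complex^'n::finite \<Rightarrow> complex) set" where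
  "fock lam = {f. entire_vec f \<and>
     integrable (mu lam) (\<lambda>z. (norm (f z))\<^sup>2 * exp (- lam * (norm z)\<^sup>2 / 2))}"

definition fock_inner ::
    "real \<Rightarrow> (complex^'n::finite \<Rightarrow> complex) \<Rightarrow> (complex^'n \<Rightarrow> complex) \<Rightarrow> complex" where
  "fock_inner lam f g =
     (\<integral>z. f z * cnj (g z) * of_real (exp (- lam * (norm z)\<^sup>2 / 2)) \<partial>mu lam)"

definition coherent :: "real \<Rightarrow> complex^'n::finite \<Rightarrow> complex^'n \<Rightarrow> complex" where
  "coherent lam z = (\<lambda>w. exp (of_real lam * bil (vcnj z) w / 2))"


section \<open>Unbounded operators, the representation and Berezin symbols\<close>

text \<open>A possibly unbounded operator is a partial map, with \<open>dom\<close> as its domain. Products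
  of operators are then \<open>\<circ>\<^sub>m\<close>, with its natural (maximal) domain.\<close>

type_synonym 'n fock_op = "(complex^'n \<Rightarrow> complex) \<rightharpoonup> (complex^'n \<Rightarrow> complex)"

definition fock_operator :: "real \<Rightarrow> 'n::finite fock_op \<Rightarrow> bool" where
  "fock_operator lam A \<longleftrightarrow>
     dom A \<subseteq> fock lam \<and> ran A \<subseteq> fock lam \<and>
     (\<forall>f\<in>dom A. \<forall>g\<in>dom A. \<forall>a b.
        A (\<lambda>w. a * f w + b * g w) = Some (\<lambda>w. a * the (A f) w + b * the (A g) w))"

definition op_inverse :: "('a \<rightharpoonup> 'b) \<Rightarrow> ('b \<rightharpoonup> 'a)" where
  "op_inverse T = (\<lambda>h. if h \<in> ran T then Some (THE f. T f = Some h) else None)"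

definition fock_rep ::
    "('n::finite \<Rightarrow> real^'m::finite \<Rightarrow> real) \<Rightarrow> (real^'m \<Rightarrow> complex) \<Rightarrow> real
      \<Rightarrow> ('n, 'm) diamond \<Rightarrow> 'n fock_op" where
  "fock_rep \<alpha> ch lam = (\<lambda>(t, z0, c0).
     (\<lambda>f. Some (\<lambda>z.
        ch t * exp (\<i> * of_real (lam * c0) + of_real (lam / 2) * bil (vcnj z0) z
                    - of_real (lam / 4 * (norm z0)\<^sup>2))
        * f (torus_act \<alpha> (- t) (z - z0)))) |` fock lam)"

text \<open>Meaningful at \<open>z\<close> only if \<open>coherent lam z \<in> dom A\<close>.\<close>

definition berezin :: "real \<Rightarrow> 'n::finite fock_op \<Rightarrow> complex^'n \<Rightarrow> complex" where
  "berezin lam A z =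
     fock_inner lam (the (A (coherent lam z))) (coherent lam z)
       / fock_inner lam (coherent lam z) (coherent lam z)"

end

theory Submission
  imports Defs
begin

text \<open>
  With \<open>p\<close> the exponential prefactor of \<open>\<pi>(g)\<close>, completing the square gives
  \<open>|p(g\<cdot>w)|\<^sup>2 exp(-\<lambda>|g\<cdot>w|\<^sup>2/2) = exp(-\<lambda>|w|\<^sup>2/2)\<close>. As \<open>w \<mapsto> g\<cdot>w\<close> is a bijective isometry, it
  preserves Lebesgue measure, so \<open>\<pi>(g)\<close> is a unitary bijection of the Fock space. Moreover
  \<open>\<pi>(g) e\<^sub>z\<close> is a nonzero multiple of \<open>e\<^bsub>g\<cdot>z\<^esub>\<close>. Hence numerator and denominator of the symbol of
  \<open>\<pi>(g)\<^sup>-\<^sup>1 A \<pi>(g)\<close> at \<open>z\<close> are those of the symbol of \<open>A\<close> at \<open>g\<cdot>z\<close> times the same positive number.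
\<close>

section \<open>Isometries preserve Lebesgue measure\<close>

lemma isometry_vimage_ball:
  fixes f :: "'a::metric_space \<Rightarrow> 'b::metric_space"
  assumes "\<And>x y. dist (f x) (f y) = dist x y"
  shows "f -` ball (f a) r = ball a r"
  using assms by (auto simp: ball_def)

text \<open>The inverse isometry serves to reverse one-sided estimates and to carry measurability
  back.\<close>

lemma isometry_inverse:
  fixes f :: "'a::metric_space \<Rightarrow> 'b::metric_space"
  assumes iso: "\<And>x y. dist (f x) (f y) = dist x y" and surj: "surj f"
  obtains g where "\<And>x y. dist (g x) (g y) = dist x y" "\<And>x. f (g x) = x" "\<And>x. g (f x) = x"
proof
  have "inj f" by (metis iso dist_eq_0_iff injI)
  then show "inv_into UNIV f (f x) = x" for x by simp
  show fg: "f (inv_into UNIV f x) = x" for x using surj by (simp add: surj_f_inv_f)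
  show "dist (inv_into UNIV f x) (inv_into UNIV f y) = dist x y" for x y by (metis iso fg)
qed

lemma isometry_borel_measurable:
  fixes f :: "'a::euclidean_space \<Rightarrow> 'a"
  assumes "\<And>x y. dist (f x) (f y) = dist x y"
  shows "f \<in> borel_measurable borel"
  by (rule borel_measurable_continuous_onI) (metis assms continuous_on_iff)

text \<open>Up to a null set an open set is a disjoint union of balls, and the preimage of a ball is a
  ball of the same radius.\<close>

lemma isometry_emeasure_vimage_ge:
  fixes f :: "'a::euclidean_space \<Rightarrow> 'a"
  assumes iso: "\<And>x y. dist (f x) (f y) = dist x y" and "surj f" and "open S"
  shows "emeasure lborel S \<le> emeasure lborel (f -` S)"
proof -
  have [measurable]: "f \<in> borel_measurable borel"
    using iso by (rule isometry_borel_measurable)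
  have [measurable]: "S \<in> sets borel" using \<open>open S\<close> by simp
  define K where "K = {(x::'a, r). 0 < r \<and> ball x r \<subseteq> S}"
  \<comment> \<open>Vitali's theorem asks for balls of arbitrarily small radius at each point of
    \<open>S\<close>; the minimum keeps the ball inside \<open>S\<close>, and halving
    \<open>d\<close> makes the bound strict.\<close>
  have "\<exists>i. i \<in> K \<and> x \<in> ball (fst i) (snd i) \<and> snd i < d" if "x \<in> S" "0 < d" for x d
  proof -
    obtain e where e: "e > 0" "ball x e \<subseteq> S"
      using \<open>open S\<close> \<open>x \<in> S\<close> openE by blast
    have "(x, min e (d/2)) \<in> K"
      using e that unfolding K_def by (auto simp: min_def)
    moreover have "x \<in> ball x (min e (d/2))" "min e (d/2) < d"
      using e that by auto
    ultimately show ?thesis by (metis fst_conv snd_conv)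
  qed
  then obtain C where C: "countable C" "C \<subseteq> K"
      and disj: "pairwise (\<lambda>i j. disjnt (ball (fst i) (snd i)) (ball (fst j) (snd j))) C"
      and neg: "negligible (S - (\<Union>i\<in>C. ball (fst i) (snd i)))"
    by (rule Vitali_covering_theorem_balls[where S = S and K = K and a = fst and r = snd])
  let ?B = "\<lambda>i. ball (fst i) (snd i) :: 'a set"
  have disjB: "disjoint_family_on ?B C"
    using disj unfolding disjoint_family_on_def pairwise_def disjnt_def by auto
  have sub: "(\<Union>i\<in>C. ?B i) \<subseteq> S"
    using C(2) unfolding K_def by fastforce
  \<comment> \<open>Surjectivity puts the centre in the range of \<open>f\<close>; the volume of a
    ball depends on its radius alone.\<close>
  have ball_eq: "emeasure lborel (f -` ball a r) = emeasure lborel (ball a r)" if "r > 0" for a r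
  proof -
    obtain b where "a = f b" using \<open>surj f\<close> by (metis surjD)
    then show ?thesis
      using isometry_vimage_ball[of f b r, OF iso] that by (simp add: emeasure_ball)
  qed
  have UB: "(\<Union>i\<in>C. ?B i) \<in> sets borel"
    using C(1) by (intro sets.countable_UN') auto
  have "S - (\<Union>i\<in>C. ?B i) \<in> null_sets lborel"
    using neg UB by (simp add: negligible_iff_null_sets null_sets_completion_iff)
  then have "emeasure lborel S = emeasure lborel (\<Union>i\<in>C. ?B i)"
    using sub UB emeasure_Un_null_set[of "\<Union>i\<in>C. ?B i" lborel "S - (\<Union>i\<in>C. ?B i)"]
    by (simp add: Un_absorb1)
  also have "\<dots> = (\<integral>\<^sup>+i. emeasure lborel (?B i) \<partial>count_space C)"
    using C(1) disjB by (intro emeasure_UN_countable) auto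
  also have "\<dots> = (\<integral>\<^sup>+i. emeasure lborel (f -` ?B i) \<partial>count_space C)"
    using C(2) by (intro nn_integral_cong) (auto simp: ball_eq K_def)
  also have "\<dots> = emeasure lborel (\<Union>i\<in>C. f -` ?B i)"
  proof (rule emeasure_UN_countable[symmetric])
    show "disjoint_family_on (\<lambda>i. f -` ?B i) C"
      using disjB unfolding disjoint_family_on_def by blast
  qed (use C(1) measurable_sets_borel[OF \<open>f \<in> borel_measurable borel\<close>] in auto)
  \<comment> \<open>Only an inequality so far: the preimage of the uncovered null set is not yet
    known to be null.\<close>
  also have "\<dots> \<le> emeasure lborel (f -` S)"
    using sub measurable_sets_borel[OF \<open>f \<in> borel_measurable borel\<close>, of S]
    by (intro emeasure_mono) auto
  finally show ?thesis .
qed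

lemma isometry_emeasure_vimage:
  fixes f :: "'a::euclidean_space \<Rightarrow> 'a"
  assumes iso: "\<And>x y. dist (f x) (f y) = dist x y" and "surj f" and "open S"
  shows "emeasure lborel (f -` S) = emeasure lborel S"
proof (rule antisym)
  obtain g where g: "\<And>x y. dist (g x) (g y) = dist x y"
    and fg: "\<And>x. f (g x) = x" and gf: "\<And>x. g (f x) = x"
    using isometry_inverse[OF iso \<open>surj f\<close>] by metis
  have "continuous_on UNIV f" by (metis iso continuous_on_iff)
  then have "open (f -` S)" using \<open>open S\<close> by (simp add: open_vimage)
  moreover have "surj g" using gf by (metis surjI)
  ultimately have "emeasure lborel (f -` S) \<le> emeasure lborel (g -` (f -` S))"
    using g by (intro isometry_emeasure_vimage_ge)
  then show "emeasure lborel (f -` S) \<le> emeasure lborel S"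
    by (simp add: vimage_def fg)
qed (use assms in \<open>intro isometry_emeasure_vimage_ge\<close>)

text \<open>Lebesgue measure is determined by its values on the boxes \<open>box l u\<close>, and
  these are open.\<close>

lemma isometry_distr_lborel:
  fixes f :: "'a::euclidean_space \<Rightarrow> 'a"
  assumes iso: "\<And>x y. dist (f x) (f y) = dist x y" and "surj f"
  shows "distr lborel borel f = lborel"
proof (rule lborel_eqI[symmetric])
  have [measurable]: "f \<in> borel_measurable borel"
    using iso by (rule isometry_borel_measurable)
  fix l u :: 'a
  assume "\<And>b. b \<in> Basis \<Longrightarrow> l \<bullet> b \<le> u \<bullet> b"
  then show "emeasure (distr lborel borel f) (box l u) = (\<Prod>b\<in>Basis. (u - l) \<bullet> b)"
    by (simp add: emeasure_distr isometry_emeasure_vimage assms open_box)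
qed simp

lemma sets_mu: "sets (mu lam) = sets borel"
  by (simp add: mu_def)

lemma isometry_distr_mu:
  fixes f :: "complex^'n::finite \<Rightarrow> complex^'n"
  assumes "\<And>x y. dist (f x) (f y) = dist x y" and "surj f"
  shows "distr (mu lam) borel f = mu lam"
proof -
  have [measurable]: "f \<in> borel_measurable borel"
    using assms(1) by (rule isometry_borel_measurable)
  have "distr (mu lam) borel f
      = density (distr lborel borel f) (\<lambda>_. ennreal (lam ^ CARD('n) / (2 * pi) ^ CARD('n)))"
    unfolding mu_def by (subst density_distr) auto
  then show ?thesis
    by (simp add: isometry_distr_lborel assms mu_def)
qed

lemma isometry_integrable_mu:
  fixes f :: "complex^'n::finite \<Rightarrow> complex^'n" and u :: "complex^'n \<Rightarrow> real"
  assumes "\<And>x y. dist (f x) (f y) = dist x y" and "surj f" and "integrable (mu lam) u"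
  shows "integrable (mu lam) (\<lambda>x. u (f x))"
proof -
  have [measurable]: "f \<in> borel_measurable borel"
    using assms(1) by (rule isometry_borel_measurable)
  have "integrable (distr (mu lam) borel f) u"
    using isometry_distr_mu[OF assms(1,2)] assms(3) by simp
  moreover have "f \<in> mu lam \<rightarrow>\<^sub>M borel" by (simp add: mu_def)
  ultimately show ?thesis by (rule integrable_distr[rotated])
qed

text \<open>For a nonmeasurable \<open>u\<close> both integrals are \<open>0\<close>, since \<open>f\<close> has a measurable inverse.\<close>

lemma isometry_integral_mu:
  fixes f :: "complex^'n::finite \<Rightarrow> complex^'n" and u :: "complex^'n \<Rightarrow> complex"
  assumes "\<And>x y. dist (f x) (f y) = dist x y" and "surj f"
  shows "(\<integral>x. u (f x) \<partial>mu lam) = (\<integral>x. u x \<partial>mu lam)"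
proof (cases "u \<in> borel_measurable borel")
  case [measurable]: True
  have "f \<in> mu lam \<rightarrow>\<^sub>M borel"
    using isometry_borel_measurable[of f, OF assms(1)] by (simp add: mu_def)
  then have "(\<integral>x. u x \<partial>distr (mu lam) borel f) = (\<integral>x. u (f x) \<partial>mu lam)"
    by (intro integral_distr) auto
  then show ?thesis by (simp add: isometry_distr_mu[OF assms])
next
  case False
  obtain g where "\<And>x y. dist (g x) (g y) = dist x y" and fg: "\<And>x. f (g x) = x"
    using isometry_inverse[OF assms] by metis
  then have "g \<in> borel_measurable borel" by (intro isometry_borel_measurable)
  then have "(\<lambda>x. u (f x)) \<notin> borel_measurable borel"
    using measurable_compose[of g borel borel "\<lambda>x. u (f x)" borel] False fg by auto
  then show ?thesis
    using False borel_measurable_integrable[of "mu lam" u]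
      borel_measurable_integrable[of "mu lam" "\<lambda>x. u (f x)"]
    by (metis measurable_cong_sets not_integrable_integral_eq sets_mu)
qed

section \<open>The bilinear form and the action\<close>

lemma bil_add_left: "bil (x + y) z = bil x z + bil y z"
  and bil_add_right: "bil z (x + y) = bil z x + bil z y"
  and bil_scale_right: "bil z (c *s x) = c * bil z x"
  by (simp_all add: bil_def ring_distribs sum.distrib sum_distrib_left ac_simps)

lemma bounded_linear_bil: "bounded_linear (bil z)"
proof -
  have "linear (bil z)"
    by (rule linearI)
      (simp_all add: bil_def ring_distribs sum.distrib scaleR_sum_right)
  then show ?thesis by (rule linear_conv_bounded_linear[THEN iffD1])
qed

lemma vcnj_add: "vcnj (x + y) = vcnj x + vcnj y"
  by (simp add: vcnj_def vec_eq_iff)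

text \<open>The real inner product is the real part of the Hermitian form
  \<open>bil (vcnj x) y\<close>.\<close>

lemma norm_add_bil:
  "(norm (x + y))\<^sup>2 = (norm x)\<^sup>2 + 2 * Re (bil (vcnj x) y) + (norm y)\<^sup>2"
proof -
  have "x \<bullet> y = Re (bil (vcnj x) y)"
    by (simp add: inner_vec_def bil_def vcnj_def inner_complex_def)
  then show ?thesis by (simp add: dot_norm)
qed

lemma Re_bil_vcnj_self: "Re (bil (vcnj x) x) = (norm x)\<^sup>2"
  by (simp add: power2_norm_eq_inner inner_vec_def bil_def vcnj_def inner_complex_def)

lemma torus_act_scale: "torus_act \<alpha> t (c *s x) = c *s torus_act \<alpha> t x"
  by (simp add: torus_act_def vec_eq_iff algebra_simps)

lemma linear_torus_act: "linear (torus_act \<alpha> t)"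
  by (rule linearI) (simp_all add: torus_act_def vec_eq_iff algebra_simps)

lemma norm_torus_act: "norm (torus_act \<alpha> t z) = norm z"
  by (simp add: torus_act_def norm_vec_def norm_mult)

lemma torus_act_minus:
  assumes "\<And>k. linear (\<alpha> k)"
  shows "torus_act \<alpha> (- t) (torus_act \<alpha> t z) = z" "torus_act \<alpha> t (torus_act \<alpha> (- t) z) = z"
  using assms
  by (simp_all add: torus_act_def vec_eq_iff linear_neg cis_mult mult.assoc[symmetric])

text \<open>The torus acts unitarily, so the adjoint of the action of \<open>- t\<close> is the
  action of \<open>t\<close>. This moves the action from the argument of a coherent state to its
  label.\<close>

lemma bil_vcnj_torus_act:
  assumes "\<And>k. linear (\<alpha> k)"
  shows "bil (vcnj z) (torus_act \<alpha> (- t) w) = bil (vcnj (torus_act \<alpha> t z)) w"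
  using assms by (simp add: bil_def vcnj_def torus_act_def linear_neg cis_cnj ac_simps)

lemma diamond_act_isometry:
  "dist (diamond_act \<alpha> g x) (diamond_act \<alpha> g y) = dist x y"
proof -
  obtain t z0 c0 where "g = (t, z0, c0)" by (cases g)
  then show ?thesis
    by (simp add: diamond_act_def dist_norm linear_diff[OF linear_torus_act, symmetric]
        norm_torus_act)
qed

lemma surj_diamond_act:
  assumes "\<And>k. linear (\<alpha> k)"
  shows "surj (diamond_act \<alpha> g)"
proof (rule surjI)
  show "diamond_act \<alpha> g (torus_act \<alpha> (- fst g) (z - fst (snd g))) = z" for z
    using assms by (simp add: diamond_act_def torus_act_minus split: prod.split)
qed

section \<open>The representation on functions\<close>

definition rep_factor ::
    "(real^'m::finite \<Rightarrow> complex) \<Rightarrow> real \<Rightarrow> ('n::finite, 'm) diamond \<Rightarrow> complex^'n \<Rightarrow> complex" where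
  "rep_factor ch lam = (\<lambda>(t, z0, c0) z.
     ch t * exp (\<i> * of_real (lam * c0) + of_real (lam / 2) * bil (vcnj z0) z
                 - of_real (lam / 4 * (norm z0)\<^sup>2)))"

text \<open>Total version of \<open>fock_rep\<close>, so that pointwise and integral identities can
  be stated for all functions.\<close>

definition rep_fun ::
    "('n::finite \<Rightarrow> real^'m::finite \<Rightarrow> real) \<Rightarrow> (real^'m \<Rightarrow> complex) \<Rightarrow> real
      \<Rightarrow> ('n, 'm) diamond \<Rightarrow> (complex^'n \<Rightarrow> complex) \<Rightarrow> complex^'n \<Rightarrow> complex" where
  "rep_fun \<alpha> ch lam = (\<lambda>(t, z0, c0) f z.
     rep_factor ch lam (t, z0, c0) z * f (torus_act \<alpha> (- t) (z - z0)))"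

lemma fock_rep_eq:
  "fock_rep \<alpha> ch lam g f = (if f \<in> fock lam then Some (rep_fun \<alpha> ch lam g f) else None)"
  by (auto simp: fock_rep_def rep_fun_def rep_factor_def restrict_map_def split: prod.splits)

text \<open>At a moved point the torus action and the translation cancel, and the representation
  becomes multiplication by the factor. Unitarity, injectivity and surjectivity are all checked at
  such points.\<close>

lemma rep_fun_act:
  assumes "\<And>k. linear (\<alpha> k)"
  shows "rep_fun \<alpha> ch lam g f (diamond_act \<alpha> g w)
    = rep_factor ch lam g (diamond_act \<alpha> g w) * f w"
  using assms by (simp add: rep_fun_def diamond_act_def torus_act_minus split: prod.splits)

lemma rep_factor_nonzero:
  assumes "unitary_character ch"
  shows "rep_factor ch lam g z \<noteq> 0"
proof -
  have "ch t \<noteq> 0" for t using assms unfolding unitary_character_def by (metis norm_zero zero_neq_one)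
  then show ?thesis by (simp add: rep_factor_def split: prod.splits)
qed

text \<open>The squared factor adds \<open>lam * Re (bil (vcnj z0) v) + lam / 2 * |z0|^2\<close> to
  the exponent. Expanding \<open>|v + z0|^2\<close> cancels exactly these terms, and
  \<open>v\<close> has the norm of \<open>w\<close>.\<close>

lemma rep_factor_gaussian:
  assumes "unitary_character ch"
  shows "(norm (rep_factor ch lam g (diamond_act \<alpha> g w)))\<^sup>2
      * exp (- lam * (norm (diamond_act \<alpha> g w))\<^sup>2 / 2) = exp (- lam * (norm w)\<^sup>2 / 2)"
proof -
  obtain t z0 c0 where g: "g = (t, z0, c0)" by (cases g)
  define v where "v = torus_act \<alpha> t w"
  have "norm (ch t) = 1" using assms by (simp add: unitary_character_def)
  then have factor: "norm (rep_factor ch lam g (v + z0))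
      = exp (lam / 2 * (Re (bil (vcnj z0) v) + (norm z0)\<^sup>2) - lam / 4 * (norm z0)\<^sup>2)"
    by (simp add: g rep_factor_def norm_mult bil_add_right Re_bil_vcnj_self)
  have square: "(norm (v + z0))\<^sup>2 = (norm z0)\<^sup>2 + 2 * Re (bil (vcnj z0) v) + (norm w)\<^sup>2"
    using norm_add_bil[of z0 v] by (simp add: add.commute v_def norm_torus_act)
  have "diamond_act \<alpha> g w = v + z0" by (simp add: g diamond_act_def v_def)
  then show ?thesis
    by (simp only: factor square flip: exp_double exp_add) (simp add: field_simps)
qed

lemma fock_inner_rep_fun:
  assumes lin: "\<And>k. linear (\<alpha> k)" and ch: "unitary_character ch"
  shows "fock_inner lam (rep_fun \<alpha> ch lam g f) (rep_fun \<alpha> ch lam g h) = fock_inner lam f h"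
proof -
  let ?a = "diamond_act \<alpha> g"
  let ?p = "\<lambda>w. rep_factor ch lam g (?a w)"
  have "fock_inner lam (rep_fun \<alpha> ch lam g f) (rep_fun \<alpha> ch lam g h)
      = (\<integral>w. rep_fun \<alpha> ch lam g f (?a w) * cnj (rep_fun \<alpha> ch lam g h (?a w))
          * of_real (exp (- lam * (norm (?a w))\<^sup>2 / 2)) \<partial>mu lam)"
    unfolding fock_inner_def
    by (rule isometry_integral_mu[symmetric, OF diamond_act_isometry surj_diamond_act[of \<alpha>, OF lin]])
  also have "\<dots> = fock_inner lam f h"
    unfolding fock_inner_def
  proof (rule Bochner_Integration.integral_cong[OF refl])
    fix w
    have "?p w * cnj (?p w) * of_real (exp (- lam * (norm (?a w))\<^sup>2 / 2))
        = of_real (exp (- lam * (norm w)\<^sup>2 / 2))"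
      unfolding complex_norm_square[symmetric] of_real_mult[symmetric] of_real_power[symmetric]
        rep_factor_gaussian[OF ch] ..
    then show "rep_fun \<alpha> ch lam g f (?a w) * cnj (rep_fun \<alpha> ch lam g h (?a w))
          * of_real (exp (- lam * (norm (?a w))\<^sup>2 / 2))
        = f w * cnj (h w) * of_real (exp (- lam * (norm w)\<^sup>2 / 2))"
      unfolding rep_fun_act[of \<alpha>, OF lin] by (simp add: ac_simps)
  qed
  finally show ?thesis .
qed

lemma rep_fun_inj:
  assumes lin: "\<And>k. linear (\<alpha> k)" and ch: "unitary_character ch"
    and eq: "rep_fun \<alpha> ch lam g f = rep_fun \<alpha> ch lam g h"
  shows "f = h"
proof
  fix w
  show "f w = h w"
    using fun_cong[OF eq, of "diamond_act \<alpha> g w"]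
    by (simp add: rep_fun_act[of \<alpha>, OF lin] rep_factor_nonzero[OF ch])
qed

text \<open>This is holomorphy of the only possible preimage of \<open>h\<close> under
  \<open>rep_fun\<close>: \<open>h\<close> after a complex affine map, times the exponential of an
  affine function.\<close>

lemma entire_vec_div_rep_factor:
  assumes "entire_vec h" and ch: "unitary_character ch"
  shows "entire_vec (\<lambda>w. h (diamond_act \<alpha> g w) / rep_factor ch lam g (diamond_act \<alpha> g w))"
  unfolding entire_vec_def
proof
  fix w
  obtain t z0 c0 where g: "g = (t, z0, c0)" by (cases g)
  let ?a = "diamond_act \<alpha> g"
  obtain h' where h': "(h has_derivative h') (at (?a w))" "\<And>c v. h' (c *s v) = c * h' v"
    using assms(1) unfolding entire_vec_def by blast
  have "bounded_linear (torus_act \<alpha> t)"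
    using linear_torus_act by (rule linear_conv_bounded_linear[THEN iffD1])
  then have a: "(?a has_derivative torus_act \<alpha> t) (at w)"
    by (simp add: g diamond_act_def has_derivative_add_const bounded_linear_imp_has_derivative)
  have ha: "((\<lambda>w. h (?a w)) has_derivative (\<lambda>v. h' (torus_act \<alpha> t v))) (at w)"
    using has_derivative_compose[OF a h'(1)] .
  have ba: "((\<lambda>w. bil (vcnj z0) (?a w)) has_derivative (\<lambda>v. bil (vcnj z0) (torus_act \<alpha> t v))) (at w)"
    using bounded_linear.has_derivative[OF bounded_linear_bil a] .
  \<comment> \<open>\<open>E\<close> is the negated exponent of the factor, so the quotient becomes
    a product with \<open>exp (E w)\<close>.\<close>
  define E where "E = (\<lambda>w. - of_real (lam / 2) * bil (vcnj z0) (?a w)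
    + (of_real (lam / 4 * (norm z0)\<^sup>2) - \<i> * of_real (lam * c0)))"
  have "(E has_derivative (\<lambda>v. - of_real (lam / 2) * bil (vcnj z0) (torus_act \<alpha> t v))) (at w)"
    unfolding E_def by (rule has_derivative_add_const[OF has_derivative_mult_right[OF ba]])
  moreover have "(exp has_derivative (\<lambda>x. exp (E w) * x)) (at (E w))"
    using DERIV_exp[of "E w"] by (simp add: has_field_derivative_def)
  ultimately have ex: "((\<lambda>w. exp (E w)) has_derivative
      (\<lambda>v. exp (E w) * (- of_real (lam / 2) * bil (vcnj z0) (torus_act \<alpha> t v)))) (at w)"
    by (rule has_derivative_compose)
  have factor: "rep_factor ch lam g (?a w) = ch t * exp (- E w)" for w
    by (simp add: g rep_factor_def E_def algebra_simps)
  have quot: "(\<lambda>w. h (?a w) / rep_factor ch lam g (?a w))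
      = (\<lambda>w. inverse (ch t) * (h (?a w) * exp (E w)))"
    unfolding factor by (simp add: exp_minus divide_inverse ac_simps)
  show "\<exists>f'. ((\<lambda>w. h (?a w) / rep_factor ch lam g (?a w)) has_derivative f') (at w)
      \<and> (\<forall>c v. f' (c *s v) = c * f' v)"
    unfolding quot
    by (rule exI, rule conjI, rule has_derivative_mult_right[OF has_derivative_mult[OF ha ex]])
      (simp add: torus_act_scale h'(2) bil_scale_right algebra_simps)
qed

text \<open>Solving \<open>rep_fun_act\<close> for the unknown function forces the witness
  \<open>?f\<close>. By the Gaussian identity its weighted square is that of \<open>h\<close> at the
  moved point, so an isometric change of variables gives integrability.\<close>

lemma rep_fun_surj:
  assumes lin: "\<And>k. linear (\<alpha> k)" and ch: "unitary_character ch" and h: "h \<in> fock lam"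
  obtains f where "f \<in> fock lam" "rep_fun \<alpha> ch lam g f = h"
proof
  let ?a = "diamond_act \<alpha> g"
  let ?f = "\<lambda>w. h (?a w) / rep_factor ch lam g (?a w)"
  have "(norm (?f w))\<^sup>2 * exp (- lam * (norm w)\<^sup>2 / 2)
      = (norm (h (?a w)))\<^sup>2 * exp (- lam * (norm (?a w))\<^sup>2 / 2)" for w
    unfolding rep_factor_gaussian[OF ch, of lam g \<alpha> w, symmetric]
    by (simp add: norm_divide power_divide rep_factor_nonzero[OF ch])
  moreover have "integrable (mu lam) (\<lambda>w. (norm (h (?a w)))\<^sup>2 * exp (- lam * (norm (?a w))\<^sup>2 / 2))"
    using h by (intro isometry_integrable_mu[OF diamond_act_isometry surj_diamond_act[of \<alpha>, OF lin]])
      (simp add: fock_def)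
  ultimately show "?f \<in> fock lam"
    using h by (simp add: fock_def entire_vec_div_rep_factor[OF _ ch])
  show "rep_fun \<alpha> ch lam g ?f = h"
  proof
    fix z
    obtain w where "z = ?a w" using surjD[OF surj_diamond_act[of \<alpha>, OF lin]] by blast
    then show "rep_fun \<alpha> ch lam g ?f z = h z"
      by (simp add: rep_fun_act[of \<alpha>, OF lin] rep_factor_nonzero[OF ch])
  qed
qed

text \<open>Surjectivity puts \<open>h\<close> in the range, and injectivity makes the description
  in \<open>op_inverse\<close> unique.\<close>

lemma op_inverse_fock_rep:
  assumes "\<And>k. linear (\<alpha> k)" and "unitary_character ch" and "h \<in> fock lam"
  obtains f where "op_inverse (fock_rep \<alpha> ch lam g) h = Some f" "rep_fun \<alpha> ch lam g f = h"
proof -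
  obtain f where f: "f \<in> fock lam" "rep_fun \<alpha> ch lam g f = h"
    using rep_fun_surj[of \<alpha>, OF assms] .
  then have fh: "fock_rep \<alpha> ch lam g f = Some h" by (simp add: fock_rep_eq)
  have "f' = f" if "fock_rep \<alpha> ch lam g f' = Some h" for f'
    using that f by (auto simp: fock_rep_eq split: if_splits intro: rep_fun_inj[of \<alpha>, OF assms(1,2)])
  with fh have "(THE f. fock_rep \<alpha> ch lam g f = Some h) = f" by blast
  then have "op_inverse (fock_rep \<alpha> ch lam g) h = Some f"
    using fh by (auto simp: op_inverse_def ran_def)
  with f(2) show thesis using that by blast
qed

text \<open>The terms of the exponent linear in \<open>w\<close> come from the conjugates of
  \<open>torus_act \<alpha> t z\<close> and \<open>z0\<close>, which add up to the conjugate of the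
  moved label.\<close>

lemma rep_fun_coherent:
  fixes \<alpha> :: "'n::finite \<Rightarrow> real^'m::finite \<Rightarrow> real"
  assumes lin: "\<And>k. linear (\<alpha> k)" and ch: "unitary_character ch"
  obtains c where "c \<noteq> 0"
    "rep_fun \<alpha> ch lam g (coherent lam z) = (\<lambda>w. c * coherent lam (diamond_act \<alpha> g z) w)"
proof -
  obtain t z0 c0 where g: "g = (t, z0, c0)" by (cases g)
  define v where "v = vcnj (torus_act \<alpha> t z)"
  \<comment> \<open>\<open>c\<close> collects all that is constant in \<open>w\<close>; its last
    term stems from evaluation at \<open>w - z0\<close>.\<close>
  define c where "c = ch t * exp (\<i> * of_real (lam * c0) - of_real (lam / 4 * (norm z0)\<^sup>2)
    - of_real lam * bil v z0 / 2)"
  have "norm (ch t) = 1" using ch by (simp add: unitary_character_def)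
  then have "c \<noteq> 0" by (auto simp: c_def)
  have bil_diff: "bil v (w - z0) = bil v w - bil v z0" for w
    by (metis bil_add_right add_diff_cancel_right' diff_add_cancel)
  have "rep_fun \<alpha> ch lam g (coherent lam z) w = c * coherent lam (diamond_act \<alpha> g z) w" for w
    unfolding g rep_fun_def rep_factor_def coherent_def diamond_act_def c_def split_conv
      bil_vcnj_torus_act[of \<alpha>, OF lin] vcnj_add bil_add_left v_def[symmetric] bil_diff mult.assoc
      exp_add[symmetric]
    by (simp add: field_simps)
  with \<open>c \<noteq> 0\<close> show thesis using that by blast
qed

section \<open>Covariance of the Berezin symbol\<close>

lemma fock_inner_scale:
  "fock_inner lam (\<lambda>w. a * f w) (\<lambda>w. b * h w) = a * cnj b * fock_inner lam f h"
  unfolding fock_inner_def integral_mult_right_zero[symmetric]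
  by (rule Bochner_Integration.integral_cong) (simp_all add: ac_simps)

theorem proposition5p2:
  fixes lam :: real
    and \<alpha> :: "'n::finite \<Rightarrow> real^'m::finite \<Rightarrow> real"
    and ch :: "real^'m \<Rightarrow> complex"
    and A :: "'n fock_op"
    and g :: "('n, 'm) diamond"
    and z :: "complex^'n"
  assumes "lam > 0"
    and "\<And>k. linear (\<alpha> k)"
    and "unitary_character ch"
    and "fock_operator lam A"
    and "\<And>w. coherent lam w \<in> dom A"
    and "g \<in> carrier (diamond_group \<alpha>)"
  shows "coherent lam z \<in> dom (op_inverse (fock_rep \<alpha> ch lam g) \<circ>\<^sub>m A \<circ>\<^sub>m fock_rep \<alpha> ch lam g)
    \<and> berezin lam (op_inverse (fock_rep \<alpha> ch lam g) \<circ>\<^sub>m A \<circ>\<^sub>m fock_rep \<alpha> ch lam g) z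
        = berezin lam A (diamond_act \<alpha> g z)"
proof -
  let ?e = "coherent lam z" and ?e' = "coherent lam (diamond_act \<alpha> g z)"
  let ?U = "fock_rep \<alpha> ch lam g" and ?u = "rep_fun \<alpha> ch lam g"
  let ?B = "op_inverse ?U \<circ>\<^sub>m A \<circ>\<^sub>m ?U"
  have sub: "dom A \<subseteq> fock lam" "ran A \<subseteq> fock lam"
    using assms(4) unfolding fock_operator_def by blast+
  have lin: "A (\<lambda>w. a * f w + b * h w) = Some (\<lambda>w. a * the (A f) w + b * the (A h) w)"
      if "f \<in> dom A" "h \<in> dom A" for f h a b
    using assms(4) that unfolding fock_operator_def by blast
  obtain c where c: "c \<noteq> 0" "?u ?e = (\<lambda>w. c * ?e' w)"
    using rep_fun_coherent[of \<alpha>, OF assms(2,3)] .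
  define h where "h = (\<lambda>w. c * the (A ?e') w)"
  have Ah: "A (?u ?e) = Some h"
    \<comment> \<open>Homogeneity is linearity with second coefficient \<open>0\<close>.\<close>
    using lin[OF assms(5) assms(5), of c _ 0] by (simp add: c(2) h_def)
  \<comment> \<open>Because \<open>A\<close> maps into the Fock space, the inverse is defined at
    \<open>h\<close>, so \<open>?e\<close> lies in the domain of the product.\<close>
  have "h \<in> fock lam" using sub(2) ranI[of A, OF Ah] by (rule subsetD)
  then obtain f where f: "op_inverse ?U h = Some f" "?u f = h"
    by (rule op_inverse_fock_rep[of \<alpha>, OF assms(2,3)])
  have "?U ?e = Some (?u ?e)"
    using assms(5) sub(1) by (auto simp: fock_rep_eq)
  then have B: "?B ?e = Some f" by (simp add: map_comp_def Ah f(1))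
  \<comment> \<open>Read backwards, unitarity inserts \<open>?u\<close> into both slots of each
    inner product; then \<open>?u f = h\<close> removes the inverse operator.\<close>
  note unitary = fock_inner_rep_fun[of \<alpha>, OF assms(2,3), of lam g, symmetric]
  have "berezin lam ?B z = fock_inner lam (?u f) (?u ?e) / fock_inner lam (?u ?e) (?u ?e)"
    unfolding berezin_def B option.sel unitary[of f] unitary[of ?e] ..
  also have "\<dots> = berezin lam A (diamond_act \<alpha> g z)"
    using c(1) by (simp add: f(2) h_def c(2) fock_inner_scale berezin_def)
  finally show ?thesis using B by blast
qed

end
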